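(* Let $(\mathbb{Z}_{(p_n)},+\mathbf{1})$ and $(\mathbb{Z}_{(q_n)},+\mathbf{1})$ be odometers with scales $(p_n)$ and $(q_n)$ respectively, both with finite torsion, and let $s$ be a prime. If $\mathbf{v}_s((q_n))=\infty$ and $\operatorname{Aut}^{(\infty)}(\mathbb{Z}_{(p_n)},+\mathbf{1})\cong\operatorname{Aut}^{(\infty)}(\mathbb{Z}_{(q_n)},+\mathbf{1})$ as groups, then $\mathbf{v}_s((p_n))=\infty$.
   Context: A scale is a sequence $(p_n)$ of positive integers with $p_n\mid p_{n+1}$, not eventually constant; the odometer is $\mathbb{Z}_{(p_n)}=\{(x_n)\in\prod_n\mathbb{Z}/p_n\mathbb{Z}: x_{n+1}\equiv x_n\bmod p_n\}$ with translation by $\mathbf{1}=(1,1,\dots)$. For a prime $p$, $\mathbf{v}_p((p_n))=\lim_n\nu_p(p_n)\in\mathbb{N}\cup\{0,\infty\}$, $\nu_p$ the $p$-adic valuation. The odometer has finite torsion if $\mathbf{v}_p((p_n))\in\{0,\infty\}$ for all but finitely many primes $p$. $\operatorname{Aut}(X,T)$ is the group of homeomorphisms commuting with $T$ and $\operatorname{Aut}^{(\infty)}(X,T)=\bigcup_{n\ge1}\operatorname{Aut}(X,T^n)\subseteq\operatorname{Homeo}(X)$. *)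

theory Defs
  imports "HOL-Analysis.Analysis" "HOL-Algebra.Group" "HOL-Computational_Algebra.Factorial_Ring"
    "HOL-Library.Extended_Nat"
begin

definition is_scale :: "(nat \<Rightarrow> nat) \<Rightarrow> bool" where
  "is_scale p \<longleftrightarrow> (\<forall>n. 0 < p n) \<and> (\<forall>n. p n dvd p (Suc n)) \<and>
     \<not> (\<exists>N. \<forall>n\<ge>N. p n = p N)"

text \<open>The odometer as a set of compatible sequences, x n in Z/p_n Z represented by {0..<p n}.\<close>
definition odo_space :: "(nat \<Rightarrow> nat) \<Rightarrow> (nat \<Rightarrow> nat) set" where
  "odo_space p = {x. (\<forall>n. x n < p n) \<and> (\<forall>n. x (Suc n) mod p n = x n)}"

definition odo_top :: "(nat \<Rightarrow> nat) \<Rightarrow> (nat \<Rightarrow> nat) topology" where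
  "odo_top p = subtopology (product_topology (\<lambda>n. discrete_topology {..<p n}) UNIV) (odo_space p)"

definition odo_T :: "(nat \<Rightarrow> nat) \<Rightarrow> (nat \<Rightarrow> nat) \<Rightarrow> (nat \<Rightarrow> nat)" where
  "odo_T p x = (\<lambda>n. (x n + 1) mod p n)"

text \<open>p-adic valuation limit v_s((p_n)) = lim nu_s(p_n) (a monotone limit, hence a supremum).\<close>
definition vval :: "nat \<Rightarrow> (nat \<Rightarrow> nat) \<Rightarrow> enat" where
  "vval s p = (SUP n. enat (multiplicity s (p n)))"

definition finite_torsion :: "(nat \<Rightarrow> nat) \<Rightarrow> bool" where
  "finite_torsion p \<longleftrightarrow> finite {s. prime s \<and> vval s p \<noteq> 0 \<and> vval s p \<noteq> \<infinity>}"

definition aut_pow :: "(nat \<Rightarrow> nat) \<Rightarrow> nat \<Rightarrow> ((nat \<Rightarrow> nat) \<Rightarrow> (nat \<Rightarrow> nat)) set" where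
  "aut_pow p m = {f. f \<in> extensional (odo_space p) \<and>
      homeomorphic_map (odo_top p) (odo_top p) f \<and>
      (\<forall>x\<in>odo_space p. f ((odo_T p ^^ m) x) = (odo_T p ^^ m) (f x))}"

definition aut_inf :: "(nat \<Rightarrow> nat) \<Rightarrow> ((nat \<Rightarrow> nat) \<Rightarrow> (nat \<Rightarrow> nat)) set" where
  "aut_inf p = (\<Union>m\<in>{1..}. aut_pow p m)"

definition aut_inf_group :: "(nat \<Rightarrow> nat) \<Rightarrow> ((nat \<Rightarrow> nat) \<Rightarrow> (nat \<Rightarrow> nat)) monoid" where
  "aut_inf_group p = \<lparr>carrier = aut_inf p,
     mult = (\<lambda>f g. restrict (f \<circ> g) (odo_space p)),
     one = restrict id (odo_space p)\<rparr>"

end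

(* Call a group virtually s-divisible if every element g has a power g^n, n > 0, that possesses
   s^k-th roots for all k. This is an isomorphism invariant.

   A homeomorphism of the odometer commuting with T^m commutes with translation by the closure of
   the multiples of m, an open subgroup, so it permutes the cosets of some H = {x. x_N = 0} and acts
   on each by a translation. A suitable power preserves every coset. If v_s((p_n)) is finite and N is
   large, multiplication by s is invertible on H, hence that power has all s^k-th roots.
   If v_s((q_n)) is infinite, no power of T itself has all s^k-th roots: otherwise some positive
   integer would be divisible by every s^k. *)

theory Submission
  imports Defs "HOL-Number_Theory.Cong"
begin

section \<open>Virtual divisibility as an isomorphism invariant\<close>

text \<open>Passing to a power discards the permutation of cosets, leaving only translations to
  divide. The exponent \<open>n\<close> is fixed before \<open>k\<close>, so that one rigidity level
  can later serve the roots of all orders; roots for different \<open>k\<close> need not be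
  compatible.\<close>

definition virtually_divisible :: "nat \<Rightarrow> ('a, 'b) monoid_scheme \<Rightarrow> bool" where
  "virtually_divisible s G \<longleftrightarrow>
     (\<forall>g\<in>carrier G. \<exists>n>0. \<forall>k. \<exists>h\<in>carrier G. h [^]\<^bsub>G\<^esub> (s ^ k) = g [^]\<^bsub>G\<^esub> (n::nat))"

lemma virtually_divisible_iso:
  assumes "group G" "group H" "G \<cong> H" "virtually_divisible s G"
  shows "virtually_divisible s H"
proof -
  from \<open>G \<cong> H\<close> obtain \<phi> where \<phi>: "\<phi> \<in> iso G H"
    by (auto simp: is_iso_def)
  then have hom: "\<phi> \<in> hom G H" and im: "\<phi> ` carrier G = carrier H"
    by (auto simp: iso_iff)
  show ?thesis
    unfolding virtually_divisible_def
  proof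
    fix g' assume "g' \<in> carrier H"
    then obtain g where g: "g \<in> carrier G" "g' = \<phi> g"
      using im by auto
    then obtain n where "n > 0"
      and n: "\<And>k. \<exists>h\<in>carrier G. h [^]\<^bsub>G\<^esub> (s ^ k) = g [^]\<^bsub>G\<^esub> (n::nat)"
      using assms(4) unfolding virtually_divisible_def by meson
    have "\<exists>h\<in>carrier H. h [^]\<^bsub>H\<^esub> (s ^ k) = g' [^]\<^bsub>H\<^esub> n" for k
    proof -
      obtain h where h: "h \<in> carrier G" "h [^]\<^bsub>G\<^esub> (s ^ k) = g [^]\<^bsub>G\<^esub> n"
        using n by blast
      then have "\<phi> h [^]\<^bsub>H\<^esub> (s ^ k) = g' [^]\<^bsub>H\<^esub> n"
        using hom_nat_pow[OF hom _ assms(1,2)] g by metis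
      then show ?thesis using h im by blast
    qed
    then show "\<exists>n>0. \<forall>k. \<exists>h\<in>carrier H. h [^]\<^bsub>H\<^esub> (s ^ k) = g' [^]\<^bsub>H\<^esub> (n::nat)"
      using \<open>n > 0\<close> by blast
  qed
qed

section \<open>Coordinate arithmetic in the odometer\<close>

lemma scale_pos: "is_scale p \<Longrightarrow> 0 < p n"
  by (simp add: is_scale_def)

lemma scale_dvd:
  assumes "is_scale p" "i \<le> j"
  shows "p i dvd p j"
  using assms(2) by (induction j rule: dec_induct)
    (use assms(1) in \<open>auto simp: is_scale_def intro: dvd_trans\<close>)

lemma odo_less: "x \<in> odo_space p \<Longrightarrow> x n < p n"
  by (simp add: odo_space_def)

lemma odo_mod:
  assumes "is_scale p" "x \<in> odo_space p" "i \<le> j"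
  shows "x j mod p i = x i"
  using assms(3)
proof (induction j rule: dec_induct)
  case base
  then show ?case using odo_less[OF assms(2)] by simp
next
  case (step j)
  have "x (Suc j) mod p i = x (Suc j) mod p j mod p i"
    using scale_dvd[OF assms(1)] step by (simp add: mod_mod_cancel)
  also have "\<dots> = x i"
    using assms(2) step by (simp add: odo_space_def)
  finally show ?case .
qed

lemma odo_eq_mono:
  assumes "is_scale p" "x \<in> odo_space p" "y \<in> odo_space p" "i \<le> j" "x j = y j"
  shows "x i = y i"
  using odo_mod[OF assms(1,2,4)] odo_mod[OF assms(1,3,4)] assms(5) by simp

text \<open>Coordinates are canonical representatives below \<open>p M\<close>. Equality of points
  can therefore be checked by integer congruences, where subtraction is available.\<close>

lemma odo_cong_imp_eq:
  assumes "x \<in> odo_space p" "y \<in> odo_space p" "[int (x M) = int (y M)] (mod int (p M))"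
  shows "x M = y M"
  using cong_less_modulus_unique_nat[of "x M" "y M" "p M"] assms odo_less
  by (auto simp: cong_int_iff)

lemma odo_cong:
  assumes "is_scale p" "x \<in> odo_space p" "i \<le> j"
  shows "[int (x j) = int (x i)] (mod int (p i))"
  using odo_mod[OF assms] odo_less[OF assms(2)] by (subst cong_int_iff) (simp add: cong_def)

lemma odo_T_funpow:
  assumes "x \<in> odo_space p"
  shows "(odo_T p ^^ m) x = (\<lambda>n. (x n + m) mod p n)"
proof (induction m)
  case 0
  then show ?case using odo_less[OF assms] by auto
next
  case (Suc m)
  then show ?case by (simp add: odo_T_def mod_Suc_eq)
qed

lemma odo_T_funpow_in:
  assumes "is_scale p" "x \<in> odo_space p"
  shows "(odo_T p ^^ m) x \<in> odo_space p"
proof -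
  have "(x (Suc n) + m) mod p (Suc n) mod p n = (x n + m) mod p n" for n
  proof -
    have "(x (Suc n) + m) mod p (Suc n) mod p n = (x (Suc n) + m) mod p n"
      using scale_dvd[OF assms(1)] by (simp add: mod_mod_cancel)
    also have "\<dots> = (x (Suc n) mod p n + m) mod p n"
      by (simp add: mod_add_left_eq)
    finally show ?thesis using assms(2) by (simp add: odo_space_def)
  qed
  then show ?thesis
    unfolding odo_T_funpow[OF assms(2)]
    using scale_pos[OF assms(1)] by (auto simp: odo_space_def)
qed

lemma zero_in_odo: "is_scale p \<Longrightarrow> (\<lambda>_. 0) \<in> odo_space p"
  by (simp add: odo_space_def scale_pos)

section \<open>Topology of the odometer\<close>

lemma topspace_odo [simp]: "topspace (odo_top p) = odo_space p"
  by (force simp: odo_top_def odo_space_def PiE_UNIV_domain)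

lemma continuous_map_odo_coord:
  "continuous_map (odo_top p) (discrete_topology {..<p n}) (\<lambda>x. x n)"
  unfolding odo_top_def
  by (rule continuous_map_from_subtopology[OF continuous_map_product_projection[OF UNIV_I]])

text \<open>A basic open set of the product constrains finitely many coordinates, and each
  coordinate determines all earlier ones, so a single coordinate \<open>K\<close> beyond the
  constrained ones suffices.\<close>

lemma openin_odo_nbhd:
  assumes "is_scale p" "openin (odo_top p) S" "x \<in> S"
  shows "\<exists>K. \<forall>z\<in>odo_space p. z K = x K \<longrightarrow> z \<in> S"
proof -
  obtain S' where S': "openin (product_topology (\<lambda>n. discrete_topology {..<p n}) UNIV) S'"
      "S = S' \<inter> odo_space p"
    using assms(2) unfolding odo_top_def openin_subtopology by blast
  then have "x \<in> S'"
    using assms(3) by blast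
  then have "\<exists>U. finite {i \<in> UNIV. U i \<noteq> topspace (discrete_topology {..<p i})} \<and>
      (\<forall>i\<in>UNIV. openin (discrete_topology {..<p i}) (U i)) \<and> x \<in> Pi\<^sub>E UNIV U \<and> Pi\<^sub>E UNIV U \<subseteq> S'"
    by (rule S'(1)[unfolded openin_product_topology_alt, rule_format])
  then obtain U where U: "finite {i. U i \<noteq> {..<p i}}" "x \<in> Pi\<^sub>E UNIV U" "Pi\<^sub>E UNIV U \<subseteq> S'"
    by auto
  obtain K where "\<forall>i\<in>{i. U i \<noteq> {..<p i}}. i \<le> K"
    using U(1) unfolding finite_nat_set_iff_bounded_le by blast
  then have K: "U i = {..<p i}" if "\<not> i \<le> K" for i
    using that by blast
  have x: "x \<in> odo_space p"
    using S' assms(3) by auto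
  show ?thesis
  proof (intro exI ballI impI)
    fix z assume z: "z \<in> odo_space p" "z K = x K"
    have "z i \<in> U i" for i
    proof (cases "i \<le> K")
      case True
      then have "z i = x i"
        using odo_eq_mono[OF assms(1) z(1) x] z(2) by blast
      then show ?thesis using PiE_mem[OF U(2), of i] by simp
    next
      case False
      then show ?thesis using K odo_less[OF z(1)] by simp
    qed
    then have "z \<in> Pi\<^sub>E UNIV U"
      by (simp add: PiE_UNIV_domain)
    then show "z \<in> S" using U(3) S'(2) z(1) by blast
  qed
qed

section \<open>Rigid maps and the cosets they permute\<close>

text \<open>Rigidity at level \<open>N\<close> says that \<open>f\<close> acts on each coset of the open subgroup
  \<open>x N = 0\<close> as a translation.\<close>

definition rigid :: "(nat \<Rightarrow> nat) \<Rightarrow> nat \<Rightarrow> ((nat \<Rightarrow> nat) \<Rightarrow> (nat \<Rightarrow> nat)) \<Rightarrow> bool" where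
  "rigid p N f \<longleftrightarrow> (\<forall>x\<in>odo_space p. \<forall>y\<in>odo_space p. x N = y N \<longrightarrow>
     (\<forall>M. [int (f y M) - int (f x M) = int (y M) - int (x M)] (mod int (p M))))"

lemma rigidD:
  assumes "rigid p N f" "x \<in> odo_space p" "y \<in> odo_space p" "x N = y N"
  shows "[int (f y M) - int (f x M) = int (y M) - int (x M)] (mod int (p M))"
  using assms by (auto simp: rigid_def)

text \<open>For \<open>M = N\<close> this makes the induced map on cosets well defined; for other
  \<open>M\<close> it bounds the information about \<open>x\<close> on which \<open>f x M\<close>
  depends.\<close>

lemma rigid_eq_coord:
  assumes "rigid p N f" "f \<in> odo_space p \<rightarrow> odo_space p"
    "x \<in> odo_space p" "y \<in> odo_space p" "x N = y N" "x M = y M"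
  shows "f x M = f y M"
proof -
  have "[int (f y M) - int (f x M) = 0] (mod int (p M))"
    using rigidD[OF assms(1,3-5), of M] assms(6) by simp
  then have "[int (f y M) = int (f x M)] (mod int (p M))"
    by (simp add: cong_diff_iff_cong_0)
  then show ?thesis
    using odo_cong_imp_eq[OF funcset_mem[OF assms(2,4)] funcset_mem[OF assms(2,3)]] by metis
qed

lemma rigid_mono:
  assumes "is_scale p" "rigid p N f" "N \<le> N'"
  shows "rigid p N' f"
  unfolding rigid_def using odo_eq_mono[OF assms(1) _ _ assms(3)] rigidD[OF assms(2)] by blast

lemma rigid_comp:
  assumes "rigid p N f" "rigid p N g" "g \<in> odo_space p \<rightarrow> odo_space p"
  shows "rigid p N (f \<circ> g)"
  unfolding rigid_def
proof (intro ballI impI allI)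
  fix x y M assume xy: "x \<in> odo_space p" "y \<in> odo_space p" "x N = y N"
  then have "g x N = g y N"
    using rigid_eq_coord[OF assms(2,3)] by blast
  then have "[int (f (g y) M) - int (f (g x) M) = int (g y M) - int (g x M)] (mod int (p M))"
    using rigidD[OF assms(1)] xy assms(3) by blast
  then show "[int ((f \<circ> g) y M) - int ((f \<circ> g) x M) = int (y M) - int (x M)] (mod int (p M))"
    using rigidD[OF assms(2) xy] by (auto intro: cong_trans)
qed

text \<open>Since \<open>f\<close> is onto, so is the induced map of the finite set of cosets, which is therefore
  one-to-one.\<close>

lemma rigid_inj_cosets:
  assumes "rigid p N f" "bij_betw f (odo_space p) (odo_space p)"
    "x \<in> odo_space p" "y \<in> odo_space p" "f x N = f y N"
  shows "x N = y N"
proof -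
  define C where "C = (\<lambda>x. x N) ` odo_space p"
  \<comment> \<open>The induced map on cosets; by \<open>rigid_eq_coord\<close> the chosen
    representative does not matter.\<close>
  define \<pi> where "\<pi> c = f (SOME x. x \<in> odo_space p \<and> x N = c) N" for c
  have f: "f \<in> odo_space p \<rightarrow> odo_space p"
    using assms(2) by (auto simp: bij_betw_def)
  have \<pi>: "\<pi> (z N) = f z N" if "z \<in> odo_space p" for z
  proof -
    let ?w = "SOME x. x \<in> odo_space p \<and> x N = z N"
    have "?w \<in> odo_space p \<and> ?w N = z N"
      by (rule someI[of _ z]) (use that in simp)
    then show ?thesis
      unfolding \<pi>_def using rigid_eq_coord[OF assms(1) f] that by blast
  qed
  have "\<pi> ` C = (\<lambda>x. f x N) ` odo_space p"
    unfolding C_def image_image using \<pi> by (rule image_cong[OF refl])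
  also have "\<dots> = (\<lambda>x. x N) ` f ` odo_space p"
    by (simp only: image_image)
  also have "\<dots> = C"
    using assms(2) by (simp add: bij_betw_def C_def)
  finally have "\<pi> ` C = C" .
  moreover have "finite C"
    unfolding C_def by (rule finite_subset[of _ "{..<p N}"]) (auto simp: odo_less)
  ultimately have "inj_on \<pi> C"
    by (simp add: eq_card_imp_inj_on)
  then show ?thesis
    by (rule inj_onD) (use \<pi> assms(3-5) in \<open>auto simp: C_def\<close>)
qed

text \<open>Preimages of points of one coset lie in one coset by \<open>rigid_inj_cosets\<close>;
  there the congruence for \<open>f\<close>, read backwards, is the one for the inverse.\<close>

lemma rigid_inv_into:
  assumes "rigid p N f" "bij_betw f (odo_space p) (odo_space p)"
  shows "rigid p N (inv_into (odo_space p) f)"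
  unfolding rigid_def
proof (intro ballI impI allI)
  let ?g = "inv_into (odo_space p) f"
  fix x y M assume xy: "x \<in> odo_space p" "y \<in> odo_space p" "x N = y N"
  have fg: "f (?g z) = z" and g: "?g z \<in> odo_space p" if "z \<in> odo_space p" for z
    using that assms(2) by (auto simp: bij_betw_def f_inv_into_f inv_into_into)
  have "?g x N = ?g y N"
    using rigid_inj_cosets[OF assms] xy fg g by metis
  then show "[int (?g y M) - int (?g x M) = int (y M) - int (x M)] (mod int (p M))"
    using rigidD[OF assms(1) g g, of x y M] xy fg by (simp add: cong_sym)
qed

section \<open>Rigid bijections are the automorphisms of powers of the translation\<close>

text \<open>The coordinate \<open>f x n\<close> depends only on \<open>x (max N n)\<close>: this
  entry fixes both the coset of \<open>x\<close> and its coordinate \<open>n\<close>. Preimages of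
  sets of values are thus preimages under one coordinate.\<close>

lemma rigid_imp_continuous:
  assumes "is_scale p" "rigid p N f" "f \<in> odo_space p \<rightarrow> odo_space p"
  shows "continuous_map (odo_top p) (odo_top p) f"
proof -
  have "continuous_map (odo_top p) (discrete_topology {..<p n}) (\<lambda>x. f x n)" for n
    unfolding continuous_map_def
  proof (intro conjI allI impI)
    show "(\<lambda>x. f x n) \<in> topspace (odo_top p) \<rightarrow> topspace (discrete_topology {..<p n})"
      using odo_less[OF funcset_mem[OF assms(3)]] by simp
    fix U
    define M where "M = max N n"
    define S where "S = {x \<in> odo_space p. f x n \<in> U}"
    define C where "C = (\<lambda>x. x M) ` S"
    have coord: "f x n = f y n" if "x \<in> odo_space p" "y \<in> odo_space p" "x M = y M" for x y
      using rigid_eq_coord[OF assms(2,3) that(1,2)] odo_eq_mono[OF assms(1) that(1,2) _ that(3)]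
      by (simp add: M_def)
    have S: "{x \<in> odo_space p. x M \<in> C} = S"
    proof
      show "S \<subseteq> {x \<in> odo_space p. x M \<in> C}"
        by (auto simp: C_def S_def)
      show "{x \<in> odo_space p. x M \<in> C} \<subseteq> S"
      proof
        fix x assume "x \<in> {x \<in> odo_space p. x M \<in> C}"
        then obtain y where "x \<in> odo_space p" "y \<in> odo_space p" "f y n \<in> U" "x M = y M"
          unfolding C_def S_def by blast
        then show "x \<in> S"
          using coord[of x y] by (simp add: S_def)
      qed
    qed
    have "C \<subseteq> {..<p M}"
      unfolding C_def S_def by (intro image_subsetI) (simp add: odo_less)
    then have "openin (odo_top p) {x \<in> topspace (odo_top p). x M \<in> C}"
      by (intro openin_continuous_map_preimage[OF continuous_map_odo_coord])
        (simp only: openin_discrete_topology)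
    then show "openin (odo_top p) {x \<in> topspace (odo_top p). f x n \<in> U}"
      by (simp only: topspace_odo S S_def)
  qed
  then have "continuous_map (odo_top p) (product_topology (\<lambda>n. discrete_topology {..<p n}) UNIV) f"
    unfolding continuous_map_componentwise_UNIV by blast
  then have "continuous_map (odo_top p) (subtopology
      (product_topology (\<lambda>n. discrete_topology {..<p n}) UNIV) (odo_space p)) f"
    by (rule continuous_map_into_subtopology) (use assms(3) in \<open>simp only: topspace_odo\<close>)
  then show ?thesis
    by (simp only: odo_top_def)
qed

text \<open>Adding \<open>p N\<close> leaves coordinate \<open>N\<close> unchanged, so
  \<open>x\<close> and its shift lie in one coset, where \<open>f\<close> is a translation and
  commutes with the shift. The inverse is rigid too, hence continuous.\<close>

lemma rigid_imp_aut_pow: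
  assumes "is_scale p" "rigid p N f" "bij_betw f (odo_space p) (odo_space p)"
    "f \<in> extensional (odo_space p)"
  shows "f \<in> aut_pow p (p N)"
proof -
  let ?X = "odo_space p" and ?g = "inv_into (odo_space p) f"
  have f: "f \<in> ?X \<rightarrow> ?X" and g: "?g \<in> ?X \<rightarrow> ?X"
    using assms(3) bij_betw_inv_into[OF assms(3)] by (auto simp: bij_betw_def)
  have "homeomorphic_maps (odo_top p) (odo_top p) f ?g"
    unfolding homeomorphic_maps_def
    using rigid_imp_continuous[OF assms(1,2) f]
      rigid_imp_continuous[OF assms(1) rigid_inv_into[OF assms(2,3)] g]
      bij_betw_inv_into_left[OF assms(3)] bij_betw_inv_into_right[OF assms(3)]
    by simp
  then have "homeomorphic_map (odo_top p) (odo_top p) f"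
    using homeomorphic_map_maps by blast
  moreover have "f ((odo_T p ^^ p N) x) = (odo_T p ^^ p N) (f x)" if x: "x \<in> ?X" for x
  proof
    fix M
    let ?y = "(odo_T p ^^ p N) x" and ?z = "(odo_T p ^^ p N) (f x)"
    have y: "?y \<in> ?X" and z: "?z \<in> ?X"
      using odo_T_funpow_in[OF assms(1)] x f by auto
    have eq: "?y i = (x i + p N) mod p i" "?z i = (f x i + p N) mod p i" for i
      using odo_T_funpow[OF x] odo_T_funpow[OF funcset_mem[OF f x]] by auto
    have "x N = ?y N"
      using eq odo_less[OF x] by simp
    then have "[int (f ?y M) - int (f x M) = int (?y M) - int (x M)] (mod int (p M))"
      using rigidD[OF assms(2) x y] by blast
    also have "[int (?y M) - int (x M) = int (x M + p N) - int (x M)] (mod int (p M))"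
      unfolding eq by (intro cong_diff cong_refl) (subst cong_int_iff, simp add: cong_def)
    finally have "[int (f ?y M) - int (f x M) + int (f x M) = int (p N) + int (f x M)] (mod int (p M))"
      by (intro cong_add) auto
    then have "[int (f ?y M) = int (f x M + p N)] (mod int (p M))"
      by (simp add: add.commute)
    also have "[int (f x M + p N) = int (?z M)] (mod int (p M))"
      unfolding eq by (subst cong_int_iff) (simp add: cong_def)
    finally show "f ?y M = ?z M"
      using odo_cong_imp_eq[OF funcset_mem[OF f y] z] by metis
  qed
  ultimately show ?thesis
    using assms(4) by (simp add: aut_pow_def)
qed

lemma aut_pow_bij:
  assumes "f \<in> aut_pow p m"
  shows "bij_betw f (odo_space p) (odo_space p)"
  using assms homeomorphic_imp_injective_map[of "odo_top p" "odo_top p" f]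
    homeomorphic_imp_surjective_map[of "odo_top p" "odo_top p" f]
  by (simp add: aut_pow_def bij_betw_def)

text \<open>The translations by multiples of \<open>m\<close> are dense among those by elements of the subgroup
  \<open>x N = 0\<close> as soon as \<open>p N\<close> absorbs every \<open>gcd m (p M)\<close>.\<close>

lemma aut_pow_rigid:
  assumes "is_scale p" "\<And>M. gcd m (p M) dvd p N" "f \<in> aut_pow p m"
  shows "rigid p N f"
  unfolding rigid_def
proof (intro ballI impI allI)
  fix x y M assume x: "x \<in> odo_space p" and y: "y \<in> odo_space p" and xy: "x N = y N"
  have f: "f \<in> odo_space p \<rightarrow> odo_space p"
    using aut_pow_bij[OF assms(3)] by (auto simp: bij_betw_def)
  have commute: "f ((odo_T p ^^ (m * j)) x) = (odo_T p ^^ (m * j)) (f x)" for j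
  proof (induction j)
    case (Suc j)
    have "f ((odo_T p ^^ (m * Suc j)) x) = f ((odo_T p ^^ m) ((odo_T p ^^ (m * j)) x))"
      by (simp add: funpow_add)
    also have "\<dots> = (odo_T p ^^ m) (f ((odo_T p ^^ (m * j)) x))"
      using assms(3) odo_T_funpow_in[OF assms(1) x] by (simp add: aut_pow_def)
    also have "\<dots> = (odo_T p ^^ (m * Suc j)) (f x)"
      by (simp add: funpow_add Suc)
    finally show ?case .
  qed simp
  have "continuous_map (odo_top p) (odo_top p) f"
    using assms(3) by (simp add: aut_pow_def homeomorphic_imp_continuous_map)
  then have "continuous_map (odo_top p) (discrete_topology {..<p M}) ((\<lambda>z. z M) \<circ> f)"
    by (rule continuous_map_compose[OF _ continuous_map_odo_coord])
  moreover have "openin (discrete_topology {..<p M}) {f y M}"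
    using odo_less[OF funcset_mem[OF f y]] by simp
  ultimately have "openin (odo_top p) {z \<in> topspace (odo_top p). ((\<lambda>z. z M) \<circ> f) z \<in> {f y M}}"
    by (rule openin_continuous_map_preimage)
  then have "openin (odo_top p) {z \<in> odo_space p. f z M = f y M}"
    by simp
  from openin_odo_nbhd[OF assms(1) this, of y] y
  obtain K where K: "\<forall>z\<in>odo_space p. z K = y K \<longrightarrow> f z M = f y M"
    by blast
  \<comment> \<open>Level \<open>K\<close> gives control of \<open>f\<close> near \<open>y\<close>
    by continuity, \<open>M\<close> is the coordinate to be compared, and \<open>N\<close> carries
    the hypothesis that \<open>x\<close> and \<open>y\<close> share a coset.\<close>
  define L where "L = max K (max M N)"
  have "[int (x L) = int (y L)] (mod int (p N))"
    using odo_cong[OF assms(1) x, of N L] odo_cong[OF assms(1) y, of N L] xy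
    by (simp add: L_def cong_def)
  then have "int (p N) dvd int (y L) - int (x L)"
    by (simp add: cong_iff_dvd_diff dvd_diff_commute)
  moreover have "int (gcd m (p L)) dvd int (p N)"
    using assms(2) by (simp only: of_nat_dvd_iff)
  ultimately have "gcd (int m) (int (p L)) dvd int (y L) - int (x L)"
    using dvd_trans[of "int (gcd m (p L))"] by (simp only: gcd_int_int_eq)
  \<comment> \<open>Solvable because the gcd of \<open>m\<close> and \<open>p L\<close> divides
    \<open>p N\<close>, which divides the difference: some multiple of \<open>m\<close> moves
    \<open>x\<close> to agree with \<open>y\<close> at level \<open>L\<close>.\<close>
  then obtain j where j: "[int m * j = int (y L) - int (x L)] (mod int (p L))"
    using cong_solve_dvd_int by blast
  define i where "i = nat (j mod int (p L))"
  have i: "int i = j mod int (p L)"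
    using scale_pos[OF assms(1), of L] by (simp add: i_def)
  have mi: "[int (m * i) = int (y L) - int (x L)] (mod int (p L))"
  proof -
    have "[int (m * i) = int m * j] (mod int (p L))"
      by (simp add: i cong_def mod_mult_right_eq)
    then show ?thesis using j cong_trans by blast
  qed
  let ?z = "(odo_T p ^^ (m * i)) x"
  have z: "?z \<in> odo_space p"
    by (rule odo_T_funpow_in[OF assms(1) x])
  have "[int (?z L) = int (x L + m * i)] (mod int (p L))"
    unfolding odo_T_funpow[OF x] by (subst cong_int_iff) (simp add: cong_def)
  also have "[int (x L + m * i) = int (x L) + (int (y L) - int (x L))] (mod int (p L))"
    unfolding of_nat_add by (rule cong_add[OF cong_refl mi])
  finally have "[int (?z L) = int (y L)] (mod int (p L))" by simp
  then have "?z L = y L"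
    using odo_cong_imp_eq z y by blast
  then have "?z K = y K"
    using odo_eq_mono[OF assms(1) z y, of K L] by (simp add: L_def)
  then have "f y M = f ?z M"
    using K z by simp
  also have "\<dots> = (f x M + m * i) mod p M"
    using commute odo_T_funpow[OF funcset_mem[OF f x]] by simp
  finally have "[int (f y M) = int (f x M + m * i)] (mod int (p M))"
    by (subst cong_int_iff) (simp add: cong_def)
  then have "[int (f y M) - int (f x M) = int (f x M + m * i) - int (f x M)] (mod int (p M))"
    by (intro cong_diff cong_refl)
  then have "[int (f y M) - int (f x M) = int (m * i)] (mod int (p M))"
    by simp
  also have "[int (m * i) = int (y L) - int (x L)] (mod int (p M))"
    using mi scale_dvd[OF assms(1), of M L] by (auto simp: L_def intro: cong_dvd_modulus)
  also have "[int (y L) - int (x L) = int (y M) - int (x M)] (mod int (p M))"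
  proof (intro cong_diff)
    show "[int (y L) = int (y M)] (mod int (p M))" "[int (x L) = int (x M)] (mod int (p M))"
      using odo_cong[OF assms(1) x, of M L] odo_cong[OF assms(1) y, of M L]
      by (simp_all add: L_def)
  qed
  finally show "[int (f y M) - int (f x M) = int (y M) - int (x M)] (mod int (p M))" .
qed

text \<open>These gcds are bounded by \<open>m\<close> and increase along divisibility, so they
  stabilise at a level where the gcd is maximal.\<close>

lemma ex_gcd_level:
  fixes m :: nat
  assumes "is_scale p" "m > 0"
  shows "\<exists>N. \<forall>M. gcd m (p M) dvd p N"
proof -
  have "\<forall>M. gcd m (p M) < Suc m"
    using gcd_le1_nat[of m] assms(2) by (simp add: less_Suc_eq_le)
  then obtain N where N: "\<And>M. gcd m (p M) \<le> gcd m (p N)"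
    using ex_has_greatest_nat[of "\<lambda>_. True" 0 "\<lambda>M. gcd m (p M)" "Suc m"] by auto
  have "gcd m (p M) dvd p N" for M
  proof (cases "M \<le> N")
    case True
    then show ?thesis
      using scale_dvd[OF assms(1), of M N] by (meson dvd_trans gcd_dvd2)
  next
    case False
    then have "gcd m (p N) dvd gcd m (p M)"
      using scale_dvd[OF assms(1), of N M] by (intro gcd_mono) auto
    moreover have "gcd m (p M) > 0" using assms(2) by simp
    ultimately have "gcd m (p M) = gcd m (p N)"
      using N[of M] dvd_imp_le le_antisym by blast
    then show ?thesis by simp
  qed
  then show ?thesis by blast
qed

text \<open>Replaces topology and the union over \<open>m\<close> by arithmetic: a given
  \<open>m\<close> yields a level \<open>N\<close> through \<open>ex_gcd_level\<close>, and a level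
  \<open>N\<close> yields \<open>m = p N\<close>.\<close>

lemma aut_inf_iff:
  assumes "is_scale p"
  shows "f \<in> aut_inf p \<longleftrightarrow> f \<in> extensional (odo_space p) \<and>
    bij_betw f (odo_space p) (odo_space p) \<and> (\<exists>N. rigid p N f)"
proof
  assume "f \<in> aut_inf p"
  then obtain m where m: "m > 0" "f \<in> aut_pow p m"
    by (auto simp: aut_inf_def Suc_le_eq)
  then show "f \<in> extensional (odo_space p) \<and> bij_betw f (odo_space p) (odo_space p) \<and>
      (\<exists>N. rigid p N f)"
    using ex_gcd_level[OF assms m(1)] aut_pow_rigid[OF assms] aut_pow_bij
    by (auto simp: aut_pow_def)
next
  assume "f \<in> extensional (odo_space p) \<and> bij_betw f (odo_space p) (odo_space p) \<and>
      (\<exists>N. rigid p N f)"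
  then obtain N where "f \<in> aut_pow p (p N)"
    using rigid_imp_aut_pow[OF assms] by blast
  then show "f \<in> aut_inf p"
    using scale_pos[OF assms, of N] by (auto simp: aut_inf_def Suc_le_eq)
qed

section \<open>The group structure\<close>

lemma rigid_cong:
  assumes "rigid p N f" "\<And>x. x \<in> odo_space p \<Longrightarrow> f x = g x"
  shows "rigid p N g"
  using assms by (auto simp: rigid_def)

lemma group_aut_inf:
  assumes "is_scale p"
  shows "group (aut_inf_group p)"
proof (rule groupI)
  let ?X = "odo_space p" and ?G = "aut_inf_group p"
  have mult: "f \<otimes>\<^bsub>?G\<^esub> g = restrict (f \<circ> g) ?X" for f g
    by (simp add: aut_inf_group_def)
  have carrier: "f \<in> carrier ?G \<longleftrightarrow> f \<in> extensional ?X \<and> bij_betw f ?X ?X \<and> (\<exists>N. rigid p N f)" for f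
    by (simp add: aut_inf_group_def aut_inf_iff[OF assms])
  have "bij_betw (restrict id ?X) ?X ?X"
    by (auto simp: bij_betw_def inj_on_def)
  moreover have "rigid p 0 (restrict id ?X)"
    by (simp add: rigid_def)
  ultimately show "\<one>\<^bsub>?G\<^esub> \<in> carrier ?G"
    unfolding carrier by (auto simp: aut_inf_group_def)
  show "f \<otimes>\<^bsub>?G\<^esub> g \<in> carrier ?G" if "f \<in> carrier ?G" "g \<in> carrier ?G" for f g
  proof -
    from that obtain N N' where f: "bij_betw f ?X ?X" "rigid p N f"
      and g: "bij_betw g ?X ?X" "rigid p N' g"
      unfolding carrier by blast
    \<comment> \<open>The factors may be rigid at different levels; rigidity passes to finer levels,
      so the larger one serves both.\<close>
    have "rigid p (max N N') (f \<circ> g)"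
      by (rule rigid_comp[OF rigid_mono[OF assms f(2)] rigid_mono[OF assms g(2)]])
        (use g in \<open>auto simp: bij_betw_def\<close>)
    then have "rigid p (max N N') (restrict (f \<circ> g) ?X)"
      by (rule rigid_cong) simp
    moreover have "bij_betw (restrict (f \<circ> g) ?X) ?X ?X"
      using bij_betw_trans[OF g(1) f(1)] by (subst bij_betw_cong[of _ _ "f \<circ> g"]) auto
    ultimately show ?thesis
      unfolding mult carrier by auto
  qed
  show "f \<otimes>\<^bsub>?G\<^esub> g \<otimes>\<^bsub>?G\<^esub> h = f \<otimes>\<^bsub>?G\<^esub> (g \<otimes>\<^bsub>?G\<^esub> h)"
    if "f \<in> carrier ?G" "g \<in> carrier ?G" "h \<in> carrier ?G" for f g h
    using that unfolding mult carrier by (auto simp: fun_eq_iff restrict_def bij_betw_def)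
  show "\<one>\<^bsub>?G\<^esub> \<otimes>\<^bsub>?G\<^esub> f = f" if "f \<in> carrier ?G" for f
    using that unfolding mult carrier
    by (auto simp: aut_inf_group_def fun_eq_iff extensional_def bij_betw_def)
  show "\<exists>g\<in>carrier ?G. g \<otimes>\<^bsub>?G\<^esub> f = \<one>\<^bsub>?G\<^esub>" if "f \<in> carrier ?G" for f
  proof
    from that obtain N where f: "bij_betw f ?X ?X" "rigid p N f"
      unfolding carrier by blast
    let ?g = "restrict (inv_into ?X f) ?X"
    have "bij_betw ?g ?X ?X"
      using bij_betw_inv_into[OF f(1)] by (subst bij_betw_cong[of _ _ "inv_into ?X f"]) auto
    moreover have "rigid p N ?g"
      using rigid_inv_into[OF f(2,1)] by (rule rigid_cong) simp
    ultimately show "?g \<in> carrier ?G"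
      unfolding carrier by auto
    show "?g \<otimes>\<^bsub>?G\<^esub> f = \<one>\<^bsub>?G\<^esub>"
      unfolding mult using f(1)
      by (auto simp: aut_inf_group_def fun_eq_iff bij_betw_def)
  qed
qed

lemma aut_inf_pow_apply:
  assumes "is_scale p" "f \<in> aut_inf p" "x \<in> odo_space p"
  shows "(f [^]\<^bsub>aut_inf_group p\<^esub> (n::nat)) x = (f ^^ n) x"
  using assms(3)
\<comment> \<open>Group powers multiply on the right, so the induction hypothesis is needed at
  \<open>f x\<close>.\<close>
proof (induction n arbitrary: x)
  case 0
  then show ?case by (simp add: aut_inf_group_def nat_pow_def)
next
  case (Suc n)
  then have "f x \<in> odo_space p"
    using assms by (auto simp: aut_inf_iff bij_betw_def)
  then show ?case
    using Suc by (simp add: aut_inf_group_def nat_pow_def funpow_swap1)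
qed

lemma aut_infI:
  assumes "is_scale p" "rigid p N f" "bij_betw f (odo_space p) (odo_space p)"
    "f \<in> extensional (odo_space p)"
  shows "f \<in> aut_inf p"
  using assms by (auto simp: aut_inf_iff)

section \<open>Iterates of rigid maps\<close>

lemma funpow_in:
  assumes "f \<in> A \<rightarrow> A" "x \<in> A"
  shows "(f ^^ n) x \<in> A"
  using assms by (induction n) auto

lemma rigid_funpow:
  assumes "rigid p N f" "f \<in> odo_space p \<rightarrow> odo_space p"
  shows "rigid p N (f ^^ n)"
proof (induction n)
  case 0
  then show ?case by (simp add: rigid_def)
next
  case (Suc n)
  then have "rigid p N (f \<circ> f ^^ n)"
    by (intro rigid_comp[OF assms(1)] Pi_I funpow_in[OF assms(2)])
  then show ?case by (simp only: funpow.simps)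
qed

lemma funpow_fixes_coset:
  assumes "rigid p N g" "g \<in> odo_space p \<rightarrow> odo_space p" "x \<in> odo_space p" "g x N = x N"
  shows "(g ^^ j) x N = x N"
proof (induction j)
  case (Suc j)
  have "(g ^^ j) x \<in> odo_space p"
    by (rule funpow_in[OF assms(2,3)])
  then have "g ((g ^^ j) x) N = g x N"
    by (rule rigid_eq_coord[OF assms(1,2) _ assms(3)]) (fact Suc)+
  then show ?case using assms(4) by simp
qed simp

text \<open>The orbit of \<open>x\<close> stays in its coset, where \<open>g\<close> always adds the
  same displacement, so \<open>j\<close> iterations add it \<open>j\<close> times.\<close>

lemma funpow_translation:
  assumes "rigid p N g" "g \<in> odo_space p \<rightarrow> odo_space p" "x \<in> odo_space p" "g x N = x N"
  shows "[int ((g ^^ j) x M) = int (x M) + int j * (int (g x M) - int (x M))] (mod int (p M))"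
proof (induction j)
  case (Suc j)
  let ?y = "(g ^^ j) x"
  have y: "?y \<in> odo_space p"
    by (rule funpow_in[OF assms(2,3)])
  have "[int (g ?y M) - int (g x M) = int (?y M) - int (x M)] (mod int (p M))"
  proof (rule rigidD[OF assms(1,3) y])
    show "x N = ?y N"
      using funpow_fixes_coset[of p N g x j] assms by simp
  qed
  then have "[int (g ?y M) - int (g x M) + int (g x M) = int (?y M) - int (x M) + int (g x M)]
      (mod int (p M))"
    by (rule cong_add[OF _ cong_refl])
  also have "[int (?y M) - int (x M) + int (g x M) =
      int (x M) + int j * (int (g x M) - int (x M)) - int (x M) + int (g x M)] (mod int (p M))"
    by (rule cong_add[OF cong_diff[OF Suc cong_refl] cong_refl])
  finally have "[int (g ?y M) - int (g x M) + int (g x M) =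
      int (x M) + int j * (int (g x M) - int (x M)) - int (x M) + int (g x M)] (mod int (p M))" .
  moreover have "int (x M) + int j * (int (g x M) - int (x M)) - int (x M) + int (g x M) =
      int (x M) + int (Suc j) * (int (g x M) - int (x M))"
    by (simp add: algebra_simps)
  moreover have "int (g ?y M) - int (g x M) + int (g x M) = int ((g ^^ Suc j) x M)"
    by simp
  ultimately show ?case
    by (simp only:)
qed simp

text \<open>By pigeonhole the coset of \<open>x\<close> returns to itself after at most
  \<open>p N\<close> steps. The return time may vary with \<open>x\<close>, but the factorial is a
  multiple of each.\<close>

lemma funpow_fact_fixes_cosets:
  assumes "rigid p N f" "bij_betw f (odo_space p) (odo_space p)" "x \<in> odo_space p"
  shows "(f ^^ fact (p N)) x N = x N"
proof -
  have f: "f \<in> odo_space p \<rightarrow> odo_space p"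
    using assms(2) by (simp add: bij_betw_imp_funcset)
  have pow: "rigid p N (f ^^ n)" "(f ^^ n) x \<in> odo_space p" for n
    using rigid_funpow[OF assms(1) f] funpow_in[OF f assms(3)] by blast+
  have "\<not> inj_on (\<lambda>i. (f ^^ i) x N) {..p N}"
  proof (rule pigeonhole)
    have "card ((\<lambda>i. (f ^^ i) x N) ` {..p N}) \<le> card {..<p N}"
      by (rule card_mono) (use odo_less[OF pow(2)] in auto)
    then show "card ((\<lambda>i. (f ^^ i) x N) ` {..p N}) < card {..p N}"
      by simp
  qed
  then obtain i j where ij: "i < j" "j \<le> p N" "(f ^^ i) x N = (f ^^ j) x N"
    unfolding inj_on_def by (metis atMost_iff linorder_neqE_nat)
  let ?d = "j - i"
  \<comment> \<open>The coinciding iterates differ by \<open>j - i\<close> steps; injectivity on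
    cosets cancels the common \<open>i\<close> steps.\<close>
  have "(f ^^ i) x N = (f ^^ i) ((f ^^ ?d) x) N"
    using ij funpow_add[of i ?d f] by simp
  then have d: "(f ^^ ?d) x N = x N"
    using rigid_inj_cosets[OF pow(1)[of i] bij_betw_funpow[OF assms(2)] assms(3) pow(2)] by simp
  have "?d dvd fact (p N)"
    using ij by (intro dvd_fact) auto
  then obtain c where c: "fact (p N) = ?d * c" ..
  have "((f ^^ ?d) ^^ c) x N = x N"
    using funpow_fixes_coset[of p N "f ^^ ?d" x c] pow(1) funpow_in[OF f] assms(3) d by simp
  then show ?thesis
    by (simp add: c funpow_mult)
qed

section \<open>Points from integer sequences, and the translation as a group element\<close>

lemma odo_of_int:
  assumes "is_scale p" "\<And>n. [a (Suc n) = a n] (mod int (p n))"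
  shows "(\<lambda>n. nat (a n mod int (p n))) \<in> odo_space p"
proof -
  have pos: "int (p n) > 0" for n
    using scale_pos[OF assms(1)] by simp
  have "nat (a n mod int (p n)) < p n" for n
    using pos_mod_bound[OF pos[of n]] pos_mod_sign[OF pos[of n]] by (simp add: nat_less_iff)
  moreover have "nat (a (Suc n) mod int (p (Suc n))) mod p n = nat (a n mod int (p n))" for n
  proof -
    have "int (p n) dvd int (p (Suc n))"
      using scale_dvd[OF assms(1)] by simp
    then have "a (Suc n) mod int (p (Suc n)) mod int (p n) = a n mod int (p n)"
      using assms(2) by (simp add: mod_mod_cancel cong_def)
    then show ?thesis
      using pos_mod_sign[OF pos[of "Suc n"], of "a (Suc n)"] by (metis nat_int nat_mod_distrib of_nat_0_le_iff)
  qed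
  ultimately show ?thesis by (simp add: odo_space_def)
qed

lemma odo_of_int_cong:
  assumes "is_scale p"
  shows "[int (nat (a mod int (p n))) = a] (mod int (p n))"
  using scale_pos[OF assms, of n] by (simp add: cong_def)

lemma restrict_odo_T_funpow:
  assumes "is_scale p" "x \<in> odo_space p"
  shows "(restrict (odo_T p) (odo_space p) ^^ n) x = (odo_T p ^^ n) x"
  using odo_T_funpow_in[OF assms] by (induction n) auto

text \<open>The map is one translation of the whole odometer, so it is rigid already at level 0, and
  continuity need not be treated separately.\<close>

lemma odo_T_in_aut_inf:
  assumes "is_scale p"
  shows "restrict (odo_T p) (odo_space p) \<in> aut_inf p"
proof (rule aut_infI[OF assms])
  let ?X = "odo_space p" and ?T = "restrict (odo_T p) (odo_space p)"
  have T: "[int (?T x M) = int (x M) + 1] (mod int (p M))" if "x \<in> ?X" for x M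
    using that by (simp add: odo_T_def cong_def zmod_int add.commute)
  have T_in: "?T x \<in> ?X" if "x \<in> ?X" for x
    using odo_T_funpow_in[OF assms that, of 1] that by simp
  show "rigid p 0 ?T"
    unfolding rigid_def
  proof (intro ballI impI allI)
    fix x y M assume "x \<in> ?X" "y \<in> ?X"
    then have "[int (?T y M) - int (?T x M) = (int (y M) + 1) - (int (x M) + 1)] (mod int (p M))"
      using T by (intro cong_diff)
    then show "[int (?T y M) - int (?T x M) = int (y M) - int (x M)] (mod int (p M))"
      by simp
  qed
  show "bij_betw ?T ?X ?X"
  proof (rule bij_betw_imageI)
    show "inj_on ?T ?X"
    proof (intro inj_onI ext)
      fix x y M assume xy: "x \<in> ?X" "y \<in> ?X" "?T x = ?T y"
      have "[int (x M) + 1 = int (y M) + 1] (mod int (p M))"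
        using T[OF xy(1), of M] T[OF xy(2), of M] xy(3) by (simp add: cong_def)
      then show "x M = y M"
        using odo_cong_imp_eq[OF xy(1,2)] by (simp add: cong_add_rcancel)
    qed
    show "?T ` ?X = ?X"
    proof (intro equalityI image_subsetI subsetI)
      fix y assume y: "y \<in> ?X"
      define x where "x = (\<lambda>n. nat ((int (y n) - 1) mod int (p n)))"
      have x: "x \<in> ?X"
        unfolding x_def by (rule odo_of_int[OF assms]) (intro cong_diff cong_refl odo_cong[OF assms y], simp)
      have "?T x M = y M" for M
      proof -
        have "[int (?T x M) = int (x M) + 1] (mod int (p M))"
          by (rule T[OF x])
        also have "[int (x M) + 1 = (int (y M) - 1) + 1] (mod int (p M))"
          unfolding x_def by (intro cong_add odo_of_int_cong[OF assms] cong_refl)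
        finally show ?thesis
          using odo_cong_imp_eq[OF T_in[OF x] y] by simp
      qed
      then show "y \<in> ?T ` ?X"
        using x by (intro image_eqI[of _ _ x]) auto
    qed (rule T_in)
  qed
qed simp

section \<open>Roots of maps that fix every coset\<close>

text \<open>On the subgroup \<open>x N = 0\<close> multiplication by \<open>c\<close> is invertible, so the translation part of
  \<open>g\<close> on each coset can be divided by \<open>c\<close>; \<open>u M\<close> is the inverse of \<open>c\<close> modulo \<open>p M / p N\<close>.\<close>

lemma rigid_root:
  assumes "is_scale p" "rigid p N g" "bij_betw g (odo_space p) (odo_space p)"
    and fix_cosets: "\<And>x. x \<in> odo_space p \<Longrightarrow> g x N = x N"
    and coprime: "\<And>M. M \<ge> N \<Longrightarrow> coprime c (p M div p N)" and "c > 0"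
  shows "\<exists>h\<in>aut_inf p. \<forall>x\<in>odo_space p. (h ^^ c) x = g x"
proof -
  let ?X = "odo_space p"
  have g: "g x \<in> ?X" if "x \<in> ?X" for x
    using assms(3) that by (rule bij_betw_apply)
  define D where "D M = (if M \<le> N then 1 else p M div p N)" for M
  define d where "d x M = int (g x M) - int (x M)" for x M
  have "coprime (int c) (int (D M))" for M
    using coprime by (simp add: D_def)
  then have "\<forall>M. \<exists>u. [int c * u = 1] (mod int (D M))"
    using cong_solve_coprime_int by blast
  then obtain u where u: "\<And>M. [int c * u M = 1] (mod int (D M))"
    by metis
  \<comment> \<open>As \<open>g\<close> fixes cosets, \<open>d x M\<close> is a multiple of
    \<open>p N\<close> for \<open>M\<close> above \<open>N\<close>, so a multiplier of it matters
    only modulo \<open>p M div p N\<close>; at lower levels \<open>d x M\<close> is 0.\<close>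
  have mult_d: "[v * d x M = w * d x M] (mod int (p M))"
    if "x \<in> ?X" "[v = w] (mod int (D M))" for v w x M
  proof (cases "M \<le> N")
    case True
    then have "d x M = 0"
      using odo_eq_mono[OF assms(1) g[OF that(1)] that(1) True] fix_cosets that(1)
      by (simp add: d_def)
    then show ?thesis by simp
  next
    case False
    have "[int (g x M) = int (g x N)] (mod int (p N))" "[int (x M) = int (x N)] (mod int (p N))"
      using odo_cong[OF assms(1) g[OF that(1)], of N M] odo_cong[OF assms(1) that(1), of N M] False
      by auto
    then have "int (p N) dvd d x M"
      using fix_cosets[OF that(1)] unfolding d_def
      by (metis cong_iff_dvd_diff cong_sym cong_trans)
    moreover have "int (D M) dvd v - w"
      using that(2) by (simp add: cong_iff_dvd_diff)
    ultimately have "int (D M) * int (p N) dvd (v - w) * d x M"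
      by (intro mult_dvd_mono)
    moreover have "D M * p N = p M"
      using False scale_dvd[OF assms(1), of N M] by (simp add: D_def)
    ultimately show ?thesis
      by (simp add: cong_iff_dvd_diff left_diff_distrib flip: of_nat_mult)
  qed
  have D_dvd: "D M dvd D (Suc M)" for M
  proof (cases "M < N")
    case False
    then show ?thesis
      using scale_dvd[OF assms(1), of N M] scale_dvd[OF assms(1), of N "Suc M"]
        scale_dvd[OF assms(1), of M "Suc M"] scale_pos[OF assms(1), of N]
      by (auto simp: D_def div_dvd_div)
  qed (simp add: D_def)
  \<comment> \<open>The inverses are chosen independently at each level, but inverses modulo
    \<open>D M\<close> are unique, which makes them compatible.\<close>
  have u_cong: "[u (Suc M) = u M] (mod int (D M))" for M
  proof -
    have "[int c * u (Suc M) = 1] (mod int (D M))"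
      using u[of "Suc M"] D_dvd[of M] by (auto intro: cong_dvd_modulus)
    then have "[int c * u (Suc M) = int c * u M] (mod int (D M))"
      using u[of M] by (metis cong_sym cong_trans)
    then show ?thesis
      using \<open>coprime (int c) (int (D M))\<close> by (simp add: cong_mult_lcancel)
  qed
  \<comment> \<open>The displacement of \<open>g\<close> divided by \<open>c\<close>: iterating
    \<open>c\<close> times adds \<open>c * u M * d x M\<close>, which is \<open>d x M\<close> modulo
    \<open>p M\<close>.\<close>
  define a where "a x M = int (x M) + u M * d x M" for x M
  define h where "h = restrict (\<lambda>x n. nat (a x n mod int (p n))) ?X"
  have h_in: "h x \<in> ?X" if x: "x \<in> ?X" for x
  proof -
    have "[a x (Suc M) = a x M] (mod int (p M))" for M
    proof -
      have d: "[d x (Suc M) = d x M] (mod int (p M))"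
        unfolding d_def by (intro cong_diff odo_cong[OF assms(1)] g x) simp_all
      have "[a x (Suc M) = int (x M) + u (Suc M) * d x M] (mod int (p M))"
        unfolding a_def by (intro cong_add cong_mult cong_refl d odo_cong[OF assms(1) x]) simp
      also have "[int (x M) + u (Suc M) * d x M = a x M] (mod int (p M))"
        unfolding a_def by (intro cong_add cong_refl mult_d x u_cong)
      finally show ?thesis .
    qed
    then show ?thesis
      using odo_of_int[OF assms(1)] x by (simp add: h_def)
  qed
  have h: "[int (h x M) = a x M] (mod int (p M))" if "x \<in> ?X" for x M
    using that odo_of_int_cong[OF assms(1)] by (simp add: h_def)
  have h_rigid: "rigid p N h"
    unfolding rigid_def
  proof (intro ballI impI allI)
    fix x y M assume xy: "x \<in> ?X" "y \<in> ?X" "x N = y N"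
    have "[int (h y M) - int (h x M) = a y M - a x M] (mod int (p M))"
      using xy by (intro cong_diff h)
    also have "a y M - a x M = (int (y M) - int (x M)) +
        u M * ((int (g y M) - int (g x M)) - (int (y M) - int (x M)))"
      by (simp add: a_def d_def algebra_simps)
    also have "[\<dots> = (int (y M) - int (x M)) +
        u M * ((int (y M) - int (x M)) - (int (y M) - int (x M)))] (mod int (p M))"
      by (intro cong_add cong_mult cong_diff[OF rigidD[OF assms(2) xy]] cong_refl)
    finally show "[int (h y M) - int (h x M) = int (y M) - int (x M)] (mod int (p M))"
      by simp
  qed
  have h_fix: "h x N = x N" if "x \<in> ?X" for x
    using h[OF that, of N] odo_cong_imp_eq[OF h_in[OF that] that] fix_cosets[OF that]
    by (simp add: a_def d_def)
  have pow: "(h ^^ c) x = g x" if x: "x \<in> ?X" for x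
  proof
    fix M
    have "(h ^^ c) x \<in> ?X"
      using h_in x by (intro funpow_in) auto
    moreover have "[int ((h ^^ c) x M) = int (g x M)] (mod int (p M))"
    proof -
      have "[int ((h ^^ c) x M) = int (x M) + int c * (int (h x M) - int (x M))] (mod int (p M))"
        using funpow_translation[of p N h x c M] h_rigid h_in x h_fix by simp
      also have "[int (x M) + int c * (int (h x M) - int (x M)) =
          int (x M) + int c * (a x M - int (x M))] (mod int (p M))"
        by (intro cong_add cong_mult cong_diff cong_refl h x)
      also have "int (x M) + int c * (a x M - int (x M)) = int (x M) + (int c * u M) * d x M"
        by (simp add: a_def)
      also have "[\<dots> = int (x M) + 1 * d x M] (mod int (p M))"
        by (intro cong_add cong_refl mult_d x u)
      finally show ?thesis
        by (simp add: d_def)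
    qed
    ultimately show "(h ^^ c) x M = g x M"
      using odo_cong_imp_eq g[OF x] by blast
  qed
  have c: "c = Suc (c - 1)"
    using \<open>c > 0\<close> by simp
  \<comment> \<open>Both halves come from \<open>h ^^ c = g\<close> on the space: peeling off one
    factor \<open>h\<close> on the right gives injectivity, on the left surjectivity.\<close>
  have "bij_betw h ?X ?X"
  proof (rule bij_betw_imageI)
    show "inj_on h ?X"
    proof (rule inj_onI)
      fix x y assume xy: "x \<in> ?X" "y \<in> ?X" "h x = h y"
      then have "(h ^^ c) x = (h ^^ c) y"
        by (subst (1 2) c) (simp add: funpow_Suc_right del: funpow.simps)
      then have "g x = g y"
        using pow xy(1,2) by simp
      then show "x = y"
        by (rule inj_onD[OF bij_betw_imp_inj_on[OF assms(3)] _ xy(1,2)])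
    qed
    show "h ` ?X = ?X"
    proof (intro equalityI image_subsetI subsetI)
      fix y assume "y \<in> ?X"
      then obtain x where x: "x \<in> ?X" "y = g x"
        using assms(3) by (auto simp: bij_betw_def)
      then have "y = h ((h ^^ (c - 1)) x)"
        using pow[OF x(1)] c by (metis comp_apply funpow.simps(2))
      moreover have "(h ^^ (c - 1)) x \<in> ?X"
        using h_in x(1) by (intro funpow_in) auto
      ultimately show "y \<in> h ` ?X" by blast
    qed (rule h_in)
  qed
  then have "h \<in> aut_inf p"
    using aut_infI[OF assms(1) h_rigid] by (simp add: h_def)
  then show ?thesis using pow by blast
qed

section \<open>Valuations and virtual divisibility\<close>

lemma vval_infinite_iff:
  assumes "is_scale p" "prime s"
  shows "vval s p = \<infinity> \<longleftrightarrow> (\<forall>k. \<exists>n. s ^ k dvd p n)"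
proof
  assume inf: "vval s p = \<infinity>"
  show "\<forall>k. \<exists>n. s ^ k dvd p n"
  proof (rule ccontr)
    assume "\<not> (\<forall>k. \<exists>n. s ^ k dvd p n)"
    then obtain k where "\<And>n. \<not> s ^ k dvd p n" by blast
    then have "multiplicity s (p n) \<le> k" for n
      by (meson multiplicity_dvd' nat_le_linear)
    then have "vval s p \<le> enat k"
      unfolding vval_def by (intro SUP_least) simp
    then show False using inf by simp
  qed
next
  assume *: "\<forall>k. \<exists>n. s ^ k dvd p n"
  have "enat k \<le> vval s p" for k
  proof -
    obtain n where n: "s ^ k dvd p n" using * by blast
    have "k \<le> multiplicity s (p n)"
      using n scale_pos[OF assms(1), of n] assms(2)
      by (intro multiplicity_geI) (auto dest: not_prime_unit)
    then have "enat k \<le> enat (multiplicity s (p n))" by simp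
    also have "\<dots> \<le> vval s p"
      unfolding vval_def by (rule SUP_upper) simp
    finally show ?thesis .
  qed
  then show "vval s p = \<infinity>"
    by (metis Suc_n_not_le_n enat.exhaust enat_ord_simps(1) not_infinity_eq)
qed

text \<open>At a level carrying the full power of \<open>s\<close> in the scale, the later quotients
  \<open>p M div p N\<close> are prime to \<open>s\<close>, so \<open>rigid_root\<close> applies
  with \<open>c = s ^ k\<close> for every \<open>k\<close>.\<close>

lemma virtually_divisible_aut_inf:
  assumes "is_scale p" "prime s" "vval s p \<noteq> \<infinity>"
  shows "virtually_divisible s (aut_inf_group p)"
  unfolding virtually_divisible_def
proof
  let ?G = "aut_inf_group p" and ?X = "odo_space p"
  interpret group ?G by (rule group_aut_inf[OF assms(1)])
  have carrier: "carrier ?G = aut_inf p"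
    by (simp add: aut_inf_group_def)
  fix f assume f: "f \<in> carrier ?G"
  then obtain N\<^sub>1 where f_bij: "bij_betw f ?X ?X" and "rigid p N\<^sub>1 f"
    by (auto simp: carrier aut_inf_iff[OF assms(1)])
  obtain k where k: "\<And>n. \<not> s ^ k dvd p n"
    using assms(3) unfolding vval_infinite_iff[OF assms(1,2)] by blast
  obtain l N\<^sub>2 where l: "s ^ l dvd p N\<^sub>2" "\<And>n. \<not> s ^ Suc l dvd p n"
  proof -
    \<comment> \<open>The least exponent whose power of \<open>s\<close> divides no term is
      positive; its predecessor is the exponent obtained outside, the finite valuation of the
      scale.\<close>
    define l where "l = (LEAST k. \<forall>n. \<not> s ^ k dvd p n)"
    have "\<forall>n. \<not> s ^ l dvd p n"
      unfolding l_def by (rule LeastI[of _ k]) (use k in blast)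
    moreover have "l \<noteq> 0"
      using \<open>\<forall>n. \<not> s ^ l dvd p n\<close> by (metis one_dvd power_0)
    then obtain m where m: "l = Suc m"
      using not0_implies_Suc by blast
    then have "\<not> (\<forall>n. \<not> s ^ m dvd p n)"
      using not_less_Least[of m "\<lambda>k. \<forall>n. \<not> s ^ k dvd p n"] by (simp add: l_def)
    ultimately show thesis
      using that m by blast
  qed
  define N where "N = max N\<^sub>1 N\<^sub>2"
  have rigid: "rigid p N f"
    using rigid_mono[OF assms(1) \<open>rigid p N\<^sub>1 f\<close>] by (simp add: N_def)
  have "s ^ l dvd p N"
    using l(1) scale_dvd[OF assms(1), of N\<^sub>2 N] dvd_trans by (simp add: N_def)
  have cop: "coprime s (p M div p N)" if "M \<ge> N" for M
  proof (rule prime_imp_coprime[OF assms(2)])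
    show "\<not> s dvd p M div p N"
    proof
      assume "s dvd p M div p N"
      then have "s * s ^ l dvd (p M div p N) * p N"
        using \<open>s ^ l dvd p N\<close> by (rule mult_dvd_mono)
      then show False
        using l(2)[of M] scale_dvd[OF assms(1) that] by simp
    qed
  qed
  let ?n = "fact (p N) :: nat"
  let ?g = "f [^]\<^bsub>?G\<^esub> ?n"
  have g: "?g \<in> carrier ?G"
    using f by simp
  have apply_g: "?g x = (f ^^ ?n) x" if "x \<in> ?X" for x
    using aut_inf_pow_apply[OF assms(1)] f that by (simp add: carrier)
  have "rigid p N ?g"
  proof (rule rigid_cong)
    show "rigid p N (f ^^ ?n)"
      using rigid_funpow[OF rigid bij_betw_imp_funcset[OF f_bij]] by blast
  qed (simp add: apply_g)
  moreover have "bij_betw ?g ?X ?X"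
    using g by (simp add: carrier aut_inf_iff[OF assms(1)])
  moreover have "?g x N = x N" if "x \<in> ?X" for x
    using apply_g[OF that] funpow_fact_fixes_cosets[OF rigid f_bij that] by simp
  ultimately have root: "\<exists>h\<in>aut_inf p. \<forall>x\<in>?X. (h ^^ (s ^ k)) x = ?g x" for k
    using cop assms(2) by (intro rigid_root[OF assms(1)]) (auto simp: prime_gt_0_nat)
  have "\<exists>h\<in>carrier ?G. h [^]\<^bsub>?G\<^esub> (s ^ k) = ?g" for k
  proof -
    obtain h where h: "h \<in> aut_inf p" "\<forall>x\<in>?X. (h ^^ (s ^ k)) x = ?g x"
      using root by blast
    have "h [^]\<^bsub>?G\<^esub> (s ^ k) \<in> carrier ?G"
      using h(1) by (intro nat_pow_closed) (simp only: carrier)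
    \<comment> \<open>Both sides are extensional, so agreement on the odometer suffices.\<close>
    then have "h [^]\<^bsub>?G\<^esub> (s ^ k) = ?g"
      using g h aut_inf_pow_apply[OF assms(1) h(1)]
      by (intro extensionalityI[of _ ?X]) (simp_all add: carrier aut_inf_iff[OF assms(1)])
    then show ?thesis using h(1) carrier by blast
  qed
  then show "\<exists>n>0. \<forall>k. \<exists>h\<in>carrier ?G. h [^]\<^bsub>?G\<^esub> (s ^ k) = f [^]\<^bsub>?G\<^esub> (n::nat)"
    using fact_gt_zero by blast
qed

text \<open>An \<open>s ^ k\<close>-th root of \<open>T ^ n\<close> commutes with \<open>T ^ n\<close>, hence is rigid at a level \<open>N\<close>
  independent of \<open>k\<close>.  A fixed power of the root then acts on the coset of \<open>0\<close> as a translation,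
  which forces \<open>s ^ k\<close> to divide \<open>n * fact (p N)\<close> for every \<open>k\<close>.\<close>

lemma not_virtually_divisible_aut_inf:
  assumes "is_scale p" "prime s" "vval s p = \<infinity>"
  shows "\<not> virtually_divisible s (aut_inf_group p)"
proof
  let ?G = "aut_inf_group p" and ?X = "odo_space p"
  let ?T = "restrict (odo_T p) ?X" and ?o = "\<lambda>_::nat. 0::nat"
  interpret group ?G by (rule group_aut_inf[OF assms(1)])
  have carrier: "carrier ?G = aut_inf p"
    by (simp add: aut_inf_group_def)
  have T: "?T \<in> carrier ?G"
    using odo_T_in_aut_inf[OF assms(1)] by (simp add: carrier)
  have apply_T: "(?T [^]\<^bsub>?G\<^esub> j) x = (odo_T p ^^ j) x" if "x \<in> ?X" for x and j :: nat
    using aut_inf_pow_apply[OF assms(1) _ that] restrict_odo_T_funpow[OF assms(1) that] T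
    by (simp add: carrier)
  assume "virtually_divisible s ?G"
  then obtain n :: nat where n: "n > 0" "\<And>k. \<exists>h\<in>carrier ?G. h [^]\<^bsub>?G\<^esub> (s ^ k) = ?T [^]\<^bsub>?G\<^esub> n"
    using T unfolding virtually_divisible_def by blast
  obtain N where N: "\<And>M. gcd n (p M) dvd p N"
    using ex_gcd_level[OF assms(1) n(1)] by blast
  define r where "r = (fact (p N) :: nat)"
  \<comment> \<open>Taking the root order from \<open>n * r\<close> itself suffices: the
    divisibility to be derived becomes \<open>s ^ k dvd k\<close>, impossible for positive
    \<open>k\<close>.\<close>
  define k where "k = n * r"
  have "k > 0"
    using n(1) by (simp add: k_def r_def)
  obtain M where M: "s ^ k dvd p M"
    using assms(3) unfolding vval_infinite_iff[OF assms(1,2)] by blast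
  obtain h where h: "h \<in> carrier ?G" "h [^]\<^bsub>?G\<^esub> (s ^ k) = ?T [^]\<^bsub>?G\<^esub> n"
    using n(2) by blast
  then have h_aut: "h \<in> aut_inf p"
    by (simp add: carrier)
  then have h_bij: "bij_betw h ?X ?X"
    by (simp add: aut_inf_iff[OF assms(1)])
  then have h_in: "h \<in> ?X \<rightarrow> ?X"
    by (rule bij_betw_imp_funcset)
  have root: "(h ^^ (s ^ k)) x = (odo_T p ^^ n) x" if "x \<in> ?X" for x
    using aut_inf_pow_apply[OF assms(1) h_aut that] apply_T[OF that] h(2) by metis
  \<comment> \<open>On the odometer the power \<open>T ^ n\<close> is an iterate of
    \<open>h\<close>, and \<open>h\<close> commutes with its own iterates.\<close>
  have "h ((odo_T p ^^ n) x) = (odo_T p ^^ n) (h x)" if "x \<in> ?X" for x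
    using root[OF that] root[OF funcset_mem[OF h_in that]] by (metis funpow_swap1)
  then have "h \<in> aut_pow p n"
    using h_aut by (auto simp: aut_inf_def aut_pow_def)
  then have h_rigid: "rigid p N h"
    using aut_pow_rigid[OF assms(1) N] by blast
  have o: "?o \<in> ?X"
    by (rule zero_in_odo[OF assms(1)])
  let ?g = "h ^^ r"
  have g: "rigid p N ?g" "?g \<in> ?X \<rightarrow> ?X"
    using rigid_funpow[OF h_rigid h_in] funpow_in[OF h_in] by blast+
  have "?g ?o N = ?o N"
    unfolding r_def by (rule funpow_fact_fixes_cosets[OF h_rigid h_bij o])
  then have "[int ((?g ^^ (s ^ k)) ?o M) = int (s ^ k) * int (?g ?o M)] (mod int (p M))"
    using funpow_translation[of p N ?g ?o "s ^ k" M] g o by simp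
  \<comment> \<open>Second evaluation of the same iterate at 0: it is also
    \<open>T ^ (n * r)\<close>. Comparing it with the translation formula modulo
    \<open>s ^ k\<close>, a divisor of \<open>p M\<close>, gives the divisibility.\<close>
  moreover have "(?g ^^ (s ^ k)) ?o M = k mod p M"
  proof -
    have "(?g ^^ (s ^ k)) ?o = (h [^]\<^bsub>?G\<^esub> (s ^ k * r)) ?o"
      using aut_inf_pow_apply[OF assms(1) h_aut o] by (simp add: funpow_mult mult.commute)
    also have "h [^]\<^bsub>?G\<^esub> (s ^ k * r) = ?T [^]\<^bsub>?G\<^esub> (n * r)"
      using h nat_pow_pow[OF h(1)] nat_pow_pow[OF T] by metis
    also have "\<dots> ?o = (odo_T p ^^ (n * r)) ?o"
      by (rule apply_T[OF o])
    finally show ?thesis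
      using odo_T_funpow[OF o] by (simp add: k_def)
  qed
  ultimately have "[int k = int (s ^ k) * int (?g ?o M)] (mod int (p M))"
    by (simp add: cong_def zmod_int)
  then have "[k = s ^ k * ?g ?o M] (mod p M)"
    by (simp flip: of_nat_mult of_nat_power add: cong_int_iff)
  then have "[k = s ^ k * ?g ?o M] (mod s ^ k)"
    using M by (rule cong_dvd_modulus_nat)
  then have "s ^ k dvd k"
    by (simp add: cong_dvd_iff)
  then have "s ^ k \<le> k"
    using \<open>k > 0\<close> by (rule dvd_imp_le)
  moreover have "k < s ^ k"
    using prime_ge_2_nat[OF assms(2)] by (intro power_gt_expt) simp
  ultimately show False by simp
qed

theorem theorem5p5:
  fixes p q :: "nat \<Rightarrow> nat" and s :: nat
  assumes "is_scale p" and "is_scale q"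
    and "finite_torsion p" and "finite_torsion q"
    and "prime s"
    and "vval s q = \<infinity>"
    and "aut_inf_group p \<cong> aut_inf_group q"
  shows "vval s p = \<infinity>"
proof (rule ccontr)
  assume "vval s p \<noteq> \<infinity>"
  then have "virtually_divisible s (aut_inf_group p)"
    by (rule virtually_divisible_aut_inf[OF assms(1,5)])
  then have "virtually_divisible s (aut_inf_group q)"
    by (rule virtually_divisible_iso[OF group_aut_inf[OF assms(1)] group_aut_inf[OF assms(2)] assms(7)])
  then show False
    using not_virtually_divisible_aut_inf[OF assms(2,5,6)] by blast
qed

end
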